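(* Let $\mathcal{A}$ be a commutative Banach algebra with non-empty character space, let $X$ be a non-empty set and let $1\le p<\infty$. Then $\ell^p(X,\mathcal{A})$ is a type I-BSE algebra if and only if $X$ is finite and $\mathcal{A}$ is a type I-BSE algebra.
   Context: $\ell^p(X,\mathcal{A})$ is the commutative Banach algebra of all $f:X\to\mathcal{A}$ with $\sum_{x\in X}\|f(x)\|^p<\infty$, with pointwise operations and norm $\|f\|_p=\big(\sum_{x\in X}\|f(x)\|^p\big)^{1/p}$. For a commutative Banach algebra $\mathcal{B}$, $\Delta(\mathcal{B})$ is the character space (nonzero multiplicative linear functionals) with the Gelfand topology, $C_b(\Delta(\mathcal{B}))$ is the algebra of bounded continuous complex functions on it, and $\hat b(\varphi)=\varphi(b)$. A function $\sigma\in C_b(\Delta(\mathcal{B}))$ is a BSE-function if there is $\beta>0$ such that $\big|\sum_{j=1}^n c_j\sigma(\varphi_j)\big|\le\beta\big\|\sum_{j=1}^n c_j\varphi_j\big\|_{\mathcal{B}^{\ast}}$ for all $n$, all $c_1,\dots,c_n\in\mathbb{C}$ and $\varphi_1,\dots,\varphi_n\in\Delta(\mathcal{B})$; $C_{BSE}(\Delta(\mathcal{B}))$ is the set of BSE-functions. $\mathcal{B}$ is without order if $b\mathcal{B}=\{0\}$ implies $b=0$. For $\mathcal{B}$ commutative and without order, $M(\mathcal{B})$ is the algebra of bounded linear $T:\mathcal{B}\to\mathcal{B}$ with $T(ab)=aT(b)$; for each $T\in M(\mathcal{B})$ there is a unique $\widehat T\in C_b(\Delta(\mathcal{B}))$ with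 $\widehat{T(b)}=\widehat T\,\hat b$ for all $b$, and $\widehat{M(\mathcal{B})}=\{\widehat T:T\in M(\mathcal{B})\}$. $\mathcal{B}$ (commutative, without order) is a BSE-algebra if $C_{BSE}(\Delta(\mathcal{B}))=\widehat{M(\mathcal{B})}$, and a type I-BSE algebra if it is a BSE-algebra and $C_{BSE}(\Delta(\mathcal{B}))=C_b(\Delta(\mathcal{B}))$. *)

theory Defs
  imports "HOL-Analysis.Analysis" "HOL-Library.Function_Algebras"
begin

text \<open>Complex algebras are not assumed to have a unit. The purely algebraic class is kept apart
  from the normed one because it also serves for the pointwise algebra of all functions into an
  algebra, of which the spaces \<open>l\<^sup>p(X, A)\<close> are subalgebras.\<close>

class comm_calgebra = comm_ring +
  fixes scaleC :: "complex \<Rightarrow> 'a \<Rightarrow> 'a"  (infixr "*\<^sub>C" 75)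
  assumes scaleC_add_right: "c *\<^sub>C (x + y) = c *\<^sub>C x + c *\<^sub>C y"
    and scaleC_add_left: "(c + d) *\<^sub>C x = c *\<^sub>C x + d *\<^sub>C x"
    and scaleC_scaleC: "c *\<^sub>C d *\<^sub>C x = (c * d) *\<^sub>C x"
    and scaleC_one: "1 *\<^sub>C x = x"
    and mult_scaleC_left: "(c *\<^sub>C x) * y = c *\<^sub>C (x * y)"

class comm_cbanach_algebra = comm_calgebra + real_normed_algebra + banach +
  assumes scaleR_eq_scaleC: "r *\<^sub>R x = complex_of_real r *\<^sub>C x"
    and norm_scaleC: "norm (c *\<^sub>C x) = cmod c * norm x"

instantiation "fun" :: (type, comm_calgebra) comm_calgebra
begin

definition scaleC_fun :: "complex \<Rightarrow> ('a \<Rightarrow> 'b) \<Rightarrow> 'a \<Rightarrow> 'b"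
  where "scaleC_fun c f = (\<lambda>x. c *\<^sub>C f x)"

instance
  by standard
    (simp_all add: scaleC_fun_def fun_eq_iff scaleC_add_right scaleC_add_left scaleC_scaleC
      scaleC_one mult_scaleC_left)

end

text \<open>In what follows a commutative Banach algebra is given by its underlying set \<open>B\<close>, a subalgebra
  of some ambient algebra from which it takes its operations, and its norm \<open>N\<close>. An algebra that is
  a whole type is \<open>UNIV\<close> with \<open>norm\<close>. Functions on \<open>B\<close>, and functions on its character space, are
  normalised to be \<open>undefined\<close> outside their domain, so that equality of functions is equality on
  the domain.\<close>

definition characters :: "'b::comm_calgebra set \<Rightarrow> ('b \<Rightarrow> complex) set"
  where "characters B = {\<phi> \<in> extensional B.
    (\<forall>a\<in>B. \<forall>b\<in>B. \<phi> (a + b) = \<phi> a + \<phi> b) \<and>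
    (\<forall>c. \<forall>a\<in>B. \<phi> (c *\<^sub>C a) = c * \<phi> a) \<and>
    (\<forall>a\<in>B. \<forall>b\<in>B. \<phi> (a * b) = \<phi> a * \<phi> b) \<and>
    (\<exists>a\<in>B. \<phi> a \<noteq> 0)}"

text \<open>The Gelfand topology is the topology of pointwise convergence on \<open>B\<close>.\<close>

definition gelfand_topology :: "'b::comm_calgebra set \<Rightarrow> ('b \<Rightarrow> complex) topology"
  where "gelfand_topology B =
    subtopology (product_topology (\<lambda>_. euclidean) B) (characters B)"

definition Cb_characters :: "'b::comm_calgebra set \<Rightarrow> (('b \<Rightarrow> complex) \<Rightarrow> complex) set"
  where "Cb_characters B = {\<sigma> \<in> extensional (characters B).
    continuous_map (gelfand_topology B) euclidean \<sigma> \<and> bounded (\<sigma> ` characters B)}"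

text \<open>Only used for linear combinations of characters. These are bounded because characters of a
  Banach algebra are automatically continuous, so the supremum is that of a bounded set.\<close>

definition dual_norm :: "'b::comm_calgebra set \<Rightarrow> ('b \<Rightarrow> real) \<Rightarrow> ('b \<Rightarrow> complex) \<Rightarrow> real"
  where "dual_norm B N \<phi> = (SUP b\<in>{b \<in> B. N b \<le> 1}. cmod (\<phi> b))"

definition BSE_functions ::
    "'b::comm_calgebra set \<Rightarrow> ('b \<Rightarrow> real) \<Rightarrow> (('b \<Rightarrow> complex) \<Rightarrow> complex) set"
  where "BSE_functions B N = {\<sigma> \<in> Cb_characters B.
    \<exists>\<beta>>0. \<forall>(n::nat) (c :: nat \<Rightarrow> complex) (\<phi> :: nat \<Rightarrow> 'b \<Rightarrow> complex).
      (\<forall>j<n. \<phi> j \<in> characters B) \<longrightarrow>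
      cmod (\<Sum>j<n. c j * \<sigma> (\<phi> j)) \<le> \<beta> * dual_norm B N (\<lambda>b. \<Sum>j<n. c j * \<phi> j b)}"

definition without_order :: "'b::comm_calgebra set \<Rightarrow> bool"
  where "without_order B \<longleftrightarrow> (\<forall>b\<in>B. (\<forall>a\<in>B. b * a = 0) \<longrightarrow> b = 0)"

definition multipliers :: "'b::comm_calgebra set \<Rightarrow> ('b \<Rightarrow> real) \<Rightarrow> ('b \<Rightarrow> 'b) set"
  where "multipliers B N = {T \<in> B \<rightarrow>\<^sub>E B.
    (\<forall>a\<in>B. \<forall>b\<in>B. T (a + b) = T a + T b) \<and>
    (\<forall>c. \<forall>a\<in>B. T (c *\<^sub>C a) = c *\<^sub>C T a) \<and>
    (\<exists>K. \<forall>a\<in>B. N (T a) \<le> K * N a) \<and>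
    (\<forall>a\<in>B. \<forall>b\<in>B. T (a * b) = a * T b)}"

text \<open>The transform of a multiplier \<open>T\<close> is the unique \<open>\<sigma>\<close> in \<open>Cb_characters B\<close> such that the
  Gelfand transform of \<open>T b\<close> is the product of \<open>\<sigma>\<close> and the Gelfand transform of \<open>b\<close>, for all \<open>b\<close>.\<close>

definition multiplier_transforms ::
    "'b::comm_calgebra set \<Rightarrow> ('b \<Rightarrow> real) \<Rightarrow> (('b \<Rightarrow> complex) \<Rightarrow> complex) set"
  where "multiplier_transforms B N = {\<sigma> \<in> Cb_characters B.
    \<exists>T\<in>multipliers B N. \<forall>b\<in>B. \<forall>\<phi>\<in>characters B. \<phi> (T b) = \<sigma> \<phi> * \<phi> b}"

definition BSE_algebra :: "'b::comm_calgebra set \<Rightarrow> ('b \<Rightarrow> real) \<Rightarrow> bool"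
  where "BSE_algebra B N \<longleftrightarrow>
    without_order B \<and> BSE_functions B N = multiplier_transforms B N"

definition type_I_BSE_algebra :: "'b::comm_calgebra set \<Rightarrow> ('b \<Rightarrow> real) \<Rightarrow> bool"
  where "type_I_BSE_algebra B N \<longleftrightarrow>
    BSE_algebra B N \<and> BSE_functions B N = Cb_characters B"

text \<open>Functions on \<open>X\<close> are represented by their extension by zero.\<close>

definition lp :: "real \<Rightarrow> 'x set \<Rightarrow> ('x \<Rightarrow> 'a::comm_cbanach_algebra) set"
  where "lp p X = {f. (\<forall>x. x \<notin> X \<longrightarrow> f x = 0) \<and> (\<lambda>x. norm (f x) powr p) summable_on X}"

definition lp_norm :: "real \<Rightarrow> 'x set \<Rightarrow> ('x \<Rightarrow> 'a::comm_cbanach_algebra) \<Rightarrow> real"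
  where "lp_norm p X f = (\<Sum>\<^sub>\<infinity>x\<in>X. norm (f x) powr p) powr (1 / p)"

end

theory Submission
  imports Defs
begin

text \<open>For infinite \<open>X\<close>, testing the constant function \<open>1\<close> on the characters \<open>f \<mapsto> \<phi> (f x)\<close> for \<open>n\<close>
  distinct points \<open>x\<close> would give \<open>n \<le> \<beta> o(n)\<close>, so \<open>1\<close> is not a BSE-function. For finite \<open>X\<close> every
  character has this form, so the character space is \<open>X \<times> \<Delta>(A)\<close>. A function on \<open>\<Delta>(A)\<close> is
  pulled back along \<open>\<Phi> \<mapsto> (\<lambda>a. \<Phi> (1\<^sub>X a))\<close>, and conversely a function on \<open>X \<times> \<Delta>(A)\<close> is treated
  on each slice \<open>{x} \<times> \<Delta>(A)\<close> separately.\<close>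

section \<open>Characters, the Gelfand topology and \<open>Cb_characters\<close>\<close>

lemma scaleC_zero_right [simp]: "c *\<^sub>C 0 = (0 :: 'a::comm_calgebra)"
  using scaleC_add_right[of c 0 0] by simp

lemma scaleC_fun_apply [simp]: "(c *\<^sub>C f) x = c *\<^sub>C f x"
  by (simp add: scaleC_fun_def)

text \<open>BSE functions and multiplier transforms are by definition taken from
  \<open>Cb_characters B\<close>, so the two set equalities reduce to two inclusions that can be
  proved independently.\<close>

lemma type_I_BSE_algebra_iff:
  "type_I_BSE_algebra B N \<longleftrightarrow>
    without_order B \<and> Cb_characters B \<subseteq> BSE_functions B N \<and>
    Cb_characters B \<subseteq> multiplier_transforms B N"
  unfolding type_I_BSE_algebra_def BSE_algebra_def BSE_functions_def multiplier_transforms_def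
  by blast

lemma characters_add: "\<phi> \<in> characters B \<Longrightarrow> a \<in> B \<Longrightarrow> b \<in> B \<Longrightarrow> \<phi> (a + b) = \<phi> a + \<phi> b"
  and characters_scaleC: "\<phi> \<in> characters B \<Longrightarrow> a \<in> B \<Longrightarrow> \<phi> (c *\<^sub>C a) = c * \<phi> a"
  and characters_mult: "\<phi> \<in> characters B \<Longrightarrow> a \<in> B \<Longrightarrow> b \<in> B \<Longrightarrow> \<phi> (a * b) = \<phi> a * \<phi> b"
  and characters_nonzero: "\<phi> \<in> characters B \<Longrightarrow> \<exists>a\<in>B. \<phi> a \<noteq> 0"
  and characters_extensional: "\<phi> \<in> characters B \<Longrightarrow> \<phi> \<in> extensional B"
  by (auto simp: characters_def)

lemma characters_zero: "\<phi> \<in> characters B \<Longrightarrow> 0 \<in> B \<Longrightarrow> \<phi> 0 = 0"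
  using characters_add[of \<phi> B 0 0] by simp

lemma characters_norm_le:
  fixes a :: "'a::comm_cbanach_algebra"
  assumes "\<phi> \<in> characters UNIV"
  shows "cmod (\<phi> a) \<le> norm a"
proof (rule ccontr)
  \<comment> \<open>Otherwise rescale so that \<open>\<phi> u = 1\<close> and \<open>norm u < 1\<close>; then \<open>u + u * b = b\<close> is solvable.\<close>
  assume *: "\<not> cmod (\<phi> a) \<le> norm a"
  define u where "u = inverse (\<phi> a) *\<^sub>C a"
  have nz: "\<phi> a \<noteq> 0" using * by auto
  then have u1: "\<phi> u = 1"
    using assms by (simp add: u_def characters_scaleC)
  have "norm u = norm a / cmod (\<phi> a)"
    by (simp add: u_def norm_scaleC norm_inverse divide_inverse mult.commute)
  then have "norm u < 1"
    using * nz by (simp add: divide_less_eq_1_pos)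
  \<comment> \<open>The map \<open>b \<mapsto> u + u * b\<close> is a contraction, so completeness
    provides a fixed point; this replaces inverting \<open>1 - u\<close> where no unit is
    available.\<close>
  moreover have "dist (u + u * x) (u + u * y) \<le> norm u * dist x y" for x y
    using norm_mult_ineq[of u "x - y"] by (simp add: dist_norm algebra_simps)
  ultimately have "\<exists>!b. u + u * b = b"
    by (intro banach_fix_type[of "norm u"]) auto
  then obtain b where "u + u * b = b" by blast
  then have "\<phi> b = 1 + \<phi> b"
    using u1 assms by (metis UNIV_I characters_add characters_mult mult_1)
  then show False by simp
qed

lemma topspace_gelfand_topology [simp]: "topspace (gelfand_topology B) = characters B"
  by (auto simp: gelfand_topology_def PiE_def dest: characters_extensional)

lemma continuous_map_gelfand_evaluation:
  "b \<in> B \<Longrightarrow> continuous_map (gelfand_topology B) euclidean (\<lambda>\<phi>. \<phi> b)"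
  unfolding gelfand_topology_def
  by (intro continuous_map_from_subtopology continuous_map_product_projection)

text \<open>The Gelfand topology is the initial topology for the evaluations at elements of
  \<open>B\<close>, so continuity can be tested on them.\<close>

lemma continuous_map_into_gelfand_topology:
  assumes "\<And>t. t \<in> topspace S \<Longrightarrow> h t \<in> characters B"
    and "\<And>b. b \<in> B \<Longrightarrow> continuous_map S euclidean (\<lambda>t. h t b)"
  shows "continuous_map S (gelfand_topology B) h"
  unfolding gelfand_topology_def continuous_map_in_subtopology continuous_map_componentwise
  using assms by (auto dest: characters_extensional)

text \<open>Pullback along a continuous map of character spaces; it carries functions in both
  directions between the character spaces of \<open>lp p X\<close> and of the base algebra.\<close>

lemma Cb_characters_compose:
  assumes "\<sigma> \<in> Cb_characters B" and "continuous_map (gelfand_topology A) (gelfand_topology B) h"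
  shows "restrict (\<sigma> \<circ> h) (characters A) \<in> Cb_characters A"
proof -
  have "h ` characters A \<subseteq> characters B"
    using continuous_map_image_subset_topspace[OF assms(2)] by simp
  then have "bounded (restrict (\<sigma> \<circ> h) (characters A) ` characters A)"
    using assms(1) by (auto simp: Cb_characters_def image_comp[symmetric] intro: bounded_subset)
  moreover have "continuous_map (gelfand_topology A) euclidean (restrict (\<sigma> \<circ> h) (characters A))"
    by (rule continuous_map_eq[OF continuous_map_compose[OF assms(2)]])
      (use assms(1) in \<open>auto simp: Cb_characters_def\<close>)
  ultimately show ?thesis by (simp add: Cb_characters_def)
qed

lemma Cb_characters_one: "restrict (\<lambda>_. 1) (characters B) \<in> Cb_characters B"
proof -
  have "continuous_map (gelfand_topology B) euclidean (restrict (\<lambda>_. 1 :: complex) (characters B))"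
    by (rule continuous_map_eq[of _ _ "\<lambda>_. 1"]) auto
  moreover have "bounded (restrict (\<lambda>_. 1 :: complex) (characters B) ` characters B)"
    by (rule boundedI[of _ 1]) auto
  ultimately show ?thesis by (simp add: Cb_characters_def)
qed

section \<open>Functions supported at one point, and \<open>lp p X\<close> as an algebra\<close>

definition single :: "'x \<Rightarrow> 'a \<Rightarrow> 'x \<Rightarrow> 'a::zero"
  where "single x a = (\<lambda>y. if y = x then a else 0)"

lemma single_same [simp]: "single x a x = a"
  by (simp add: single_def)

lemma single_add: "single x (a + b) = single x a + single x (b :: 'a::monoid_add)"
  by (auto simp: single_def)

lemma single_mult: "single x (a * b) = single x a * single x (b :: 'a::mult_zero)"
  by (auto simp: single_def)

lemma single_scaleC: "single x (c *\<^sub>C a) = c *\<^sub>C single x (a :: 'a::comm_calgebra)"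
  by (auto simp: single_def)

text \<open>The functions supported at \<open>x\<close> form an ideal on which a factor
  \<open>f\<close> acts only through \<open>f x\<close>; this isolates one coordinate although there
  may be no unit.\<close>

lemma mult_single: "f * single x a = single x (f x * (a :: 'b::mult_zero))"
  by (auto simp: single_def)

lemma lpD: "f \<in> lp p X \<Longrightarrow> x \<notin> X \<Longrightarrow> f x = 0"
  and lp_summable: "f \<in> lp p X \<Longrightarrow> (\<lambda>x. norm (f x) powr p) summable_on X"
  by (auto simp: lp_def)

lemma lp_finite: "finite X \<Longrightarrow> f \<in> lp p X \<longleftrightarrow> (\<forall>x. x \<notin> X \<longrightarrow> f x = 0)"
  by (simp add: lp_def)

lemma lp_norm_finite:
  "finite X \<Longrightarrow> lp_norm p X f = (\<Sum>x\<in>X. norm (f x) powr p) powr (1 / p)"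
  by (simp add: lp_norm_def)

lemma zero_in_lp [simp]: "0 \<in> lp p X"
  by (simp add: lp_def)

lemma sum_le_lp_norm_powr:
  assumes "f \<in> lp p X" "0 < p" "finite F" "F \<subseteq> X"
  shows "(\<Sum>x\<in>F. norm (f x) powr p) \<le> lp_norm p X f powr p"
proof -
  have "(\<Sum>x\<in>F. norm (f x) powr p) \<le> (\<Sum>\<^sub>\<infinity>x\<in>X. norm (f x) powr p)"
    using assms by (intro finite_sum_le_infsum) (auto simp: lp_def)
  then show ?thesis
    using assms by (simp add: lp_norm_def powr_powr infsum_nonneg)
qed

lemma norm_le_lp_norm:
  assumes "f \<in> lp p X" "0 < p" "x \<in> X"
  shows "norm (f x) \<le> lp_norm p X f"
proof -
  have "norm (f x) powr p \<le> lp_norm p X f powr p"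
    using sum_le_lp_norm_powr[OF assms(1,2), of "{x}"] assms(3) by simp
  then show ?thesis
    using powr_less_mono2[OF assms(2), of "lp_norm p X f" "norm (f x)"]
    by (fastforce simp: lp_norm_def)
qed

lemma lp_add:
  assumes "f \<in> lp p X" "g \<in> lp p X" "0 < p"
  shows "f + g \<in> lp p X"
proof -
  have "norm (f x + g x) powr p \<le> 2 powr p * (norm (f x) powr p + norm (g x) powr p)" for x
  proof -
    \<comment> \<open>Bounding the sum of the two norms by twice the larger one takes the place of
      Minkowski's inequality and works for every positive \<open>p\<close>.\<close>
    define m where "m = max (norm (f x)) (norm (g x))"
    have "norm (f x + g x) powr p \<le> (2 * m) powr p"
      using norm_triangle_ineq[of "f x" "g x"] assms(3)
      by (intro powr_mono2) (auto simp: m_def)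
    also have "\<dots> = 2 powr p * m powr p"
      by (simp add: powr_mult m_def)
    also have "m powr p \<le> norm (f x) powr p + norm (g x) powr p"
      by (auto simp: m_def max_def)
    finally show ?thesis by simp
  qed
  moreover have "(\<lambda>x. 2 powr p * (norm (f x) powr p + norm (g x) powr p)) summable_on X"
    by (intro summable_on_cmult_right summable_on_add lp_summable assms)
  ultimately have "(\<lambda>x. norm ((f + g) x) powr p) summable_on X"
    by (auto intro: summable_on_comparison_test)
  then show ?thesis using assms by (simp add: lp_def)
qed

lemma lp_scaleC:
  assumes "f \<in> lp p X"
  shows "c *\<^sub>C f \<in> lp p X"
proof -
  have "(\<lambda>x. norm ((c *\<^sub>C f) x) powr p) = (\<lambda>x. cmod c powr p * norm (f x) powr p)"
    by (auto simp: norm_scaleC powr_mult)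
  then show ?thesis
    using assms by (auto simp: lp_def intro: summable_on_cmult_right)
qed

text \<open>A member of \<open>lp p X\<close> is bounded by its norm, so the product is dominated by
  a constant multiple of the second factor.\<close>

lemma lp_mult:
  assumes "f \<in> lp p X" "g \<in> lp p X" "0 < p"
  shows "f * g \<in> lp p X"
proof -
  have "norm (f x * g x) powr p \<le> lp_norm p X f powr p * norm (g x) powr p" if "x \<in> X" for x
  proof -
    have "norm (f x * g x) \<le> lp_norm p X f * norm (g x)"
      using norm_mult_ineq[of "f x" "g x"] norm_le_lp_norm[OF assms(1,3) that]
      by (meson mult_right_mono norm_ge_zero order_trans)
    then have "norm (f x * g x) powr p \<le> (lp_norm p X f * norm (g x)) powr p"
      using assms(3) by (intro powr_mono2) auto
    then show ?thesis by (simp add: powr_mult lp_norm_def)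
  qed
  moreover have "(\<lambda>x. lp_norm p X f powr p * norm (g x) powr p) summable_on X"
    by (intro summable_on_cmult_right lp_summable assms)
  ultimately have "(\<lambda>x. norm ((f * g) x) powr p) summable_on X"
    by (auto intro: summable_on_comparison_test)
  then show ?thesis using assms by (simp add: lp_def)
qed

lemma
  fixes a :: "'a::comm_cbanach_algebra"
  assumes "x \<in> X" "0 < p"
  shows single_in_lp: "single x a \<in> lp p X"
    and lp_norm_single: "lp_norm p X (single x a) = norm a"
proof -
  have "((\<lambda>y. norm (single x a y) powr p) has_sum norm a powr p) X"
    using assms by (intro has_sum_finite_neutralI[of "{x}"]) (auto simp: single_def)
  then show "single x a \<in> lp p X" "lp_norm p X (single x a) = norm a"
    using assms by (auto simp: lp_def lp_norm_def single_def powr_powr summable_on_def infsumI)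
qed

lemma lp_norm_zero [simp]: "lp_norm p X 0 = 0"
  by (simp add: lp_norm_def)

section \<open>Point characters, and the character space for finite \<open>X\<close>\<close>

definition point_character ::
    "real \<Rightarrow> 'x set \<Rightarrow> 'x \<Rightarrow> ('a \<Rightarrow> complex) \<Rightarrow> ('x \<Rightarrow> 'a::comm_cbanach_algebra) \<Rightarrow> complex"
  where "point_character p X x \<phi> = restrict (\<lambda>f. \<phi> (f x)) (lp p X)"

lemma point_character_apply: "f \<in> lp p X \<Longrightarrow> point_character p X x \<phi> f = \<phi> (f x)"
  by (simp add: point_character_def)

lemma point_character_in_characters:
  fixes \<phi> :: "'a::comm_cbanach_algebra \<Rightarrow> complex"
  assumes "\<phi> \<in> characters UNIV" "x \<in> X" "0 < p"
  shows "point_character p X x \<phi> \<in> characters (lp p X)"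
proof -
  obtain a where "\<phi> a \<noteq> 0" using characters_nonzero[OF assms(1)] by blast
  then have "\<exists>f\<in>lp p X. point_character p X x \<phi> f \<noteq> 0"
    using assms single_in_lp[of x X p a]
    by (intro bexI[of _ "single x a"]) (auto simp: point_character_apply)
  then show ?thesis
    using assms unfolding characters_def[of "lp p X"]
    by (auto simp: point_character_def lp_add lp_scaleC lp_mult
        characters_add characters_scaleC characters_mult)
qed

lemma continuous_map_point_character:
  assumes "x \<in> X" "0 < p"
  shows "continuous_map (gelfand_topology (UNIV :: 'a::comm_cbanach_algebra set))
    (gelfand_topology (lp p X)) (point_character p X x)"
  using assms
  by (intro continuous_map_into_gelfand_topology)
    (auto simp: point_character_in_characters point_character_apply
      intro: continuous_map_gelfand_evaluation)

text \<open>Membership and additivity go through the induction together, since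
  \<open>characters_add\<close> applies only to partial sums already known to lie in
  \<open>lp p X\<close>.\<close>

lemma characters_lp_sum:
  assumes "\<Phi> \<in> characters (lp p X)" "0 < p" "finite I" "\<And>i. i \<in> I \<Longrightarrow> f i \<in> lp p X"
  shows "(\<Sum>i\<in>I. f i) \<in> lp p X \<and> \<Phi> (\<Sum>i\<in>I. f i) = (\<Sum>i\<in>I. \<Phi> (f i))"
  using assms(3,4)
  by (induction I) (use assms(1,2) in \<open>auto simp: characters_zero characters_add lp_add\<close>)

lemma sum_single:
  fixes f :: "'x \<Rightarrow> 'a::comm_monoid_add"
  assumes "finite X" "\<And>x. x \<notin> X \<Longrightarrow> f x = 0"
  shows "(\<Sum>x\<in>X. single x (f x)) = f"
proof
  fix y
  have "(\<Sum>x\<in>Y. single x (f x)) y = (\<Sum>x\<in>Y. single x (f x) y)" for Y :: "'x set"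
    by (induction Y rule: infinite_finite_induct) auto
  then show "(\<Sum>x\<in>X. single x (f x)) y = f y"
    using assms by (auto simp: single_def)
qed

text \<open>For finite \<open>X\<close> every element is the sum of its one-point parts, so
  \<open>\<Phi>\<close> is nonzero on some part. The point \<open>x\<close> of that part determines
  the form of \<open>\<Phi>\<close>, because the functions supported at \<open>x\<close> are an
  ideal on which \<open>\<Phi>\<close> does not vanish.\<close>

lemma characters_lp_finite:
  fixes \<Phi> :: "('x \<Rightarrow> 'a::comm_cbanach_algebra) \<Rightarrow> complex"
  assumes "\<Phi> \<in> characters (lp p X)" "finite X" "0 < p"
  obtains x \<phi> where "x \<in> X" "\<phi> \<in> characters UNIV" "\<Phi> = point_character p X x \<phi>"
proof -
  obtain f where f: "f \<in> lp p X" "\<Phi> f \<noteq> 0"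
    using characters_nonzero[OF assms(1)] by blast
  have "(\<Sum>x\<in>X. \<Phi> (single x (f x))) \<noteq> 0"
    using characters_lp_sum[OF assms(1,3,2), of "\<lambda>x. single x (f x)"] f assms
    by (simp add: single_in_lp sum_single[OF assms(2)] lpD)
  then obtain x where x: "x \<in> X" "\<Phi> (single x (f x)) \<noteq> 0"
    by (meson sum.neutral)
  define \<phi> where "\<phi> = (\<lambda>a. \<Phi> (single x a))"
  have "\<phi> \<in> characters UNIV"
    unfolding characters_def \<phi>_def using x assms
    by (auto simp: single_add single_mult single_scaleC single_in_lp
        characters_add characters_mult characters_scaleC)
  \<comment> \<open>Multiplication by \<open>single x (f x)\<close> does not distinguish
    \<open>g\<close> from \<open>single x (g x)\<close>; the factor
    \<open>\<Phi> (single x (f x))\<close> is nonzero and cancels.\<close>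
  moreover have "\<Phi> g = \<phi> (g x)" if "g \<in> lp p X" for g
  proof -
    have "\<Phi> g * \<Phi> (single x (f x)) = \<Phi> (g * single x (f x))"
      using that x assms by (simp add: characters_mult single_in_lp)
    also have "g * single x (f x) = single x (g x) * single x (f x)"
      by (simp add: mult_single)
    also have "\<Phi> \<dots> = \<Phi> (single x (g x)) * \<Phi> (single x (f x))"
      using x assms by (simp add: characters_mult single_in_lp)
    finally have "\<Phi> g * \<Phi> (single x (f x)) = \<Phi> (single x (g x)) * \<Phi> (single x (f x))" .
    then show ?thesis using x by (simp add: \<phi>_def)
  qed
  then have "\<Phi> = point_character p X x \<phi>"
    using characters_extensional[OF assms(1)]
    by (auto simp: point_character_def fun_eq_iff extensional_def)
  ultimately show thesis using that x by blast
qed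

section \<open>Dual norm estimates, and the constant function \<open>1\<close> for infinite
  \<open>X\<close>\<close>

lemma norm_combination_le:
  assumes "\<And>j. j < n \<Longrightarrow> cmod (z j) \<le> (1 :: real)"
  shows "cmod (\<Sum>j<n. c j * z j) \<le> (\<Sum>j<(n::nat). cmod (c j))"
  using assms by (intro sum_norm_le) (auto simp: norm_mult mult_left_le)

text \<open>A value lies below the supremum in \<open>dual_norm\<close> only once the set is known
  to be bounded; characters being contractive, \<open>\<Sum>j<n. cmod (c j)\<close> is a
  bound.\<close>

lemma norm_combination_le_dual_norm:
  fixes a :: "'a::comm_cbanach_algebra"
  assumes "\<And>j. j < n \<Longrightarrow> \<phi> j \<in> characters UNIV" "norm a \<le> 1"
  shows "cmod (\<Sum>j<(n::nat). c j * \<phi> j a) \<le> dual_norm UNIV norm (\<lambda>b. \<Sum>j<n. c j * \<phi> j b)"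
  unfolding dual_norm_def
proof (rule cSUP_upper)
  have "cmod (\<phi> j b) \<le> 1" if "norm b \<le> 1" "j < n" for b j
    using characters_norm_le[OF assms(1)[OF that(2)], of b] that(1) by (rule order_trans)
  then show "bdd_above ((\<lambda>b. cmod (\<Sum>j<n. c j * \<phi> j b)) ` {b \<in> UNIV. norm b \<le> 1})"
    by (intro bdd_aboveI2[where M = "\<Sum>j<n. cmod (c j)"] norm_combination_le) auto
qed (use assms in auto)

text \<open>Evaluation at a point of \<open>X\<close> is contractive on \<open>lp p X\<close>, so
  the same bound on the supremum works.\<close>

lemma norm_combination_le_dual_norm_lp:
  fixes f :: "'x \<Rightarrow> 'a::comm_cbanach_algebra"
  assumes "\<And>j. j < n \<Longrightarrow> \<phi> j \<in> characters UNIV" "\<And>j. j < n \<Longrightarrow> x j \<in> X" "0 < p"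
    and "f \<in> lp p X" "lp_norm p X f \<le> 1"
  shows "cmod (\<Sum>j<(n::nat). c j * \<phi> j (f (x j)))
    \<le> dual_norm (lp p X) (lp_norm p X) (\<lambda>g. \<Sum>j<n. c j * point_character p X (x j) (\<phi> j) g)"
proof -
  have "cmod (\<Sum>j<n. c j * point_character p X (x j) (\<phi> j) f)
    \<le> dual_norm (lp p X) (lp_norm p X) (\<lambda>g. \<Sum>j<n. c j * point_character p X (x j) (\<phi> j) g)"
    unfolding dual_norm_def
  proof (rule cSUP_upper)
    have "cmod (point_character p X (x j) (\<phi> j) g) \<le> 1"
      if "g \<in> lp p X" "lp_norm p X g \<le> 1" "j < n" for g j
      using that assms(1-3) characters_norm_le[of "\<phi> j" "g (x j)"] norm_le_lp_norm[of g p X "x j"]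
      by (simp add: point_character_apply)
    then show "bdd_above ((\<lambda>g. cmod (\<Sum>j<n. c j * point_character p X (x j) (\<phi> j) g)) `
        {g \<in> lp p X. lp_norm p X g \<le> 1})"
      by (intro bdd_aboveI2[where M = "\<Sum>j<n. cmod (c j)"] norm_combination_le) auto
  qed (use assms in auto)
  then show ?thesis using assms(4) by (simp add: point_character_apply)
qed

text \<open>All characters sit at the same point. Evaluation at \<open>x\<close> maps the unit ball
  of \<open>lp p X\<close> into that of the base algebra, so no new values enter the
  supremum.\<close>

lemma dual_norm_point_characters_le:
  fixes \<phi> :: "nat \<Rightarrow> 'a::comm_cbanach_algebra \<Rightarrow> complex"
  assumes "\<And>j. j < n \<Longrightarrow> \<phi> j \<in> characters UNIV" "x \<in> X" "0 < p"
  shows "dual_norm (lp p X) (lp_norm p X) (\<lambda>g. \<Sum>j<n. c j * point_character p X x (\<phi> j) g)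
    \<le> dual_norm UNIV norm (\<lambda>b. \<Sum>j<n. c j * \<phi> j b)"
  unfolding dual_norm_def[of "lp p X"]
proof (rule cSUP_least)
  show "{g :: 'b \<Rightarrow> 'a. g \<in> lp p X \<and> lp_norm p X g \<le> 1} \<noteq> {}"
    by (auto intro!: exI[of _ 0])
  fix g :: "'b \<Rightarrow> 'a" assume "g \<in> {g. g \<in> lp p X \<and> lp_norm p X g \<le> 1}"
  then have "g \<in> lp p X" "norm (g x) \<le> 1"
    using norm_le_lp_norm[of g p X x] assms by auto
  then show "cmod (\<Sum>j<n. c j * point_character p X x (\<phi> j) g)
      \<le> dual_norm UNIV norm (\<lambda>b. \<Sum>j<n. c j * \<phi> j b)"
    using norm_combination_le_dual_norm[OF assms(1), where a = "g x" and c = c and n = n]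
    by (simp add: point_character_apply)
qed

text \<open>The sum of \<open>n\<close> point characters over distinct points has dual norm \<open>o(n)\<close>, so the constant
  function \<open>1\<close> is not a BSE-function. The crude splitting into small and large values below
  replaces Hoelder's inequality.\<close>

lemma infinite_one_notin_BSE_functions:
  fixes \<phi> :: "'a::comm_cbanach_algebra \<Rightarrow> complex" and X :: "'x set"
  assumes "\<phi> \<in> characters UNIV" "infinite X" "0 < p"
  shows "restrict (\<lambda>_. 1) (characters (lp p X :: ('x \<Rightarrow> 'a) set))
    \<notin> BSE_functions (lp p X :: ('x \<Rightarrow> 'a) set) (lp_norm p X)"
proof
  assume "restrict (\<lambda>_. 1) (characters (lp p X :: ('x \<Rightarrow> 'a) set))
    \<in> BSE_functions (lp p X :: ('x \<Rightarrow> 'a) set) (lp_norm p X)"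
  then obtain \<beta> where \<beta>: "\<beta> > 0"
    "\<And>(n::nat) c \<Phi>. \<forall>j<n. \<Phi> j \<in> characters (lp p X :: ('x \<Rightarrow> 'a) set) \<Longrightarrow>
      cmod (\<Sum>j<n. c j * restrict (\<lambda>_. 1) (characters (lp p X)) (\<Phi> j))
      \<le> \<beta> * dual_norm (lp p X) (lp_norm p X) (\<lambda>b. \<Sum>j<n. c j * \<Phi> j b)"
    unfolding BSE_functions_def by blast
  obtain x :: "nat \<Rightarrow> 'x" where x: "inj x" "range x \<subseteq> X"
    using assms(2) infinite_countable_subset by blast
  \<comment> \<open>With this choice \<open>\<beta> * \<epsilon> = 1 / 2\<close>, so the linear term
    of the bound below absorbs only half of \<open>n\<close>.\<close>
  define \<epsilon> where "\<epsilon> = 1 / (2 * \<beta>)"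
  have \<epsilon>: "\<epsilon> > 0" using \<beta>(1) by (simp add: \<epsilon>_def)
  have bound: "(\<Sum>j<n. norm (g (x j))) \<le> \<epsilon> * n + \<epsilon> powr (- p)"
    if g: "g \<in> lp p X" "lp_norm p X g \<le> 1" for g :: "'x \<Rightarrow> 'a" and n :: nat
  proof -
    have "norm (g (x j)) \<le> \<epsilon> + \<epsilon> powr (- p) * norm (g (x j)) powr p" for j
    proof (cases "norm (g (x j)) \<le> \<epsilon>")
      \<comment> \<open>A value above \<open>\<epsilon>\<close> is still at most \<open>1\<close>,
        hence at most the \<open>p\<close>-th power of its quotient by
        \<open>\<epsilon>\<close>.\<close>
      case False
      then have "1 \<le> (norm (g (x j)) / \<epsilon>) powr p"
        using \<epsilon> assms(3) by (intro ge_one_powr_ge_zero) auto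
      moreover have "norm (g (x j)) \<le> 1"
        using norm_le_lp_norm[OF g(1) assms(3), of "x j"] x(2) g(2)
        by (meson order_trans rangeI subsetD)
      moreover have "(norm (g (x j)) / \<epsilon>) powr p = \<epsilon> powr (- p) * norm (g (x j)) powr p"
        using \<epsilon> by (simp add: powr_divide powr_minus_divide)
      ultimately show ?thesis
        using \<epsilon> by linarith
    qed (use \<epsilon> in \<open>simp add: add_increasing2\<close>)
    then have "(\<Sum>j<n. norm (g (x j)))
        \<le> (\<Sum>j<n. \<epsilon> + \<epsilon> powr (- p) * norm (g (x j)) powr p)"
      by (rule sum_mono)
    \<comment> \<open>Injectivity of \<open>x\<close> turns the sum over indices into a sum over
      distinct points, which the norm of \<open>g\<close> controls.\<close>
    also have "\<dots> = \<epsilon> * n + \<epsilon> powr (- p) * (\<Sum>y\<in>x ` {..<n}. norm (g y) powr p)"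
      using x by (simp add: sum.distrib sum_distrib_left sum.reindex inj_on_def inj_def)
    also have "\<dots> \<le> \<epsilon> * n + \<epsilon> powr (- p) * 1"
    proof (intro add_left_mono mult_left_mono)
      have "(\<Sum>y\<in>x ` {..<n}. norm (g y) powr p) \<le> lp_norm p X g powr p"
        using x(2) by (intro sum_le_lp_norm_powr[OF g(1) assms(3)]) auto
      also have "\<dots> \<le> 1"
        using g(2) assms(3) by (intro powr_le1) (auto simp: lp_norm_def)
      finally show "(\<Sum>y\<in>x ` {..<n}. norm (g y) powr p) \<le> 1" .
    qed simp
    finally show ?thesis by simp
  qed
  have "n \<le> \<beta> * (\<epsilon> * n + \<epsilon> powr (- p))" for n :: nat
  proof -
    have ch: "point_character p X (x j) \<phi> \<in> characters (lp p X)" for j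
      using assms x by (auto intro: point_character_in_characters)
    \<comment> \<open>All coefficients and all values of the test function are \<open>1\<close>, so
      the left side of the BSE inequality is \<open>n\<close>.\<close>
    then have "real n \<le> \<beta> * dual_norm (lp p X) (lp_norm p X)
        (\<lambda>b. \<Sum>j<n. 1 * point_character p X (x j) \<phi> b)"
      using \<beta>(2)[of n "\<lambda>j. point_character p X (x j) \<phi>" "\<lambda>_. 1"] by simp
    also have "dual_norm (lp p X) (lp_norm p X) (\<lambda>b. \<Sum>j<n. 1 * point_character p X (x j) \<phi> b)
        \<le> \<epsilon> * n + \<epsilon> powr (- p)"
      unfolding dual_norm_def
    proof (rule cSUP_least)
      show "{g :: 'x \<Rightarrow> 'a. g \<in> lp p X \<and> lp_norm p X g \<le> 1} \<noteq> {}"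
        by (auto intro!: exI[of _ 0])
      fix g :: "'x \<Rightarrow> 'a" assume g: "g \<in> {g. g \<in> lp p X \<and> lp_norm p X g \<le> 1}"
      have "cmod (\<Sum>j<n. 1 * point_character p X (x j) \<phi> g) \<le> (\<Sum>j<n. norm (g (x j)))"
        using g by (intro sum_norm_le)
          (auto simp: point_character_apply characters_norm_le[OF assms(1)])
      also have "\<dots> \<le> \<epsilon> * n + \<epsilon> powr (- p)" using bound g by blast
      finally show "cmod (\<Sum>j<n. 1 * point_character p X (x j) \<phi> g) \<le> \<epsilon> * n + \<epsilon> powr (- p)" .
    qed
    finally show ?thesis using \<beta>(1) by simp
  qed
  \<comment> \<open>The inequality reads
    \<open>n \<le> n / 2 + \<beta> * \<epsilon> powr (- p)\<close>, which would bound all natural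
    numbers.\<close>
  then have "real n \<le> 2 * \<beta> * \<epsilon> powr (- p)" for n :: nat
    using \<beta>(1) by (simp add: \<epsilon>_def field_simps)
  then show False
    by (meson not_le reals_Archimedean2)
qed

section \<open>From \<open>lp p X\<close> to the base algebra, for finite \<open>X\<close>\<close>

lemma type_I_BSE_algebra_base:
  fixes X :: "'x set"
  assumes lp: "type_I_BSE_algebra (lp p X :: ('x \<Rightarrow> 'a::comm_cbanach_algebra) set) (lp_norm p X)"
    and X: "finite X" "x \<in> X" and p: "0 < p"
  shows "type_I_BSE_algebra (UNIV :: 'a set) norm"
  unfolding type_I_BSE_algebra_iff
proof (intro conjI subsetI)
  show "without_order (UNIV :: 'a set)"
    unfolding without_order_def
  proof (intro ballI impI)
    fix b :: 'a assume "\<forall>a\<in>UNIV. b * a = 0"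
    then have "single x b * f = 0" for f :: "'x \<Rightarrow> 'a"
      by (auto simp: single_def)
    then have "single x b = 0"
      using lp single_in_lp[OF X(2) p]
      unfolding type_I_BSE_algebra_iff without_order_def by blast
    then show "b = 0" by (metis single_same zero_fun_apply)
  qed
next
  fix \<sigma> assume \<sigma>: "\<sigma> \<in> Cb_characters (UNIV :: 'a set)"
  \<comment> \<open>Testing on functions constant on \<open>X\<close> recovers \<open>\<phi>\<close>
    from a point character at any point; testing on \<open>single x a\<close> would give the zero
    functional at the other points. These functions lie in \<open>lp p X\<close> because
    \<open>X\<close> is finite.\<close>
  define r :: "(('x \<Rightarrow> 'a) \<Rightarrow> complex) \<Rightarrow> 'a \<Rightarrow> complex"
    where "r = (\<lambda>\<Phi> a. \<Phi> (\<lambda>y. if y \<in> X then a else 0))"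
  have const: "(\<lambda>y. if y \<in> X then a else 0) \<in> lp p X" for a :: 'a
    using X by (simp add: lp_finite)
  have r: "r (point_character p X y \<phi>) = \<phi>" if "y \<in> X" for y \<phi>
    using that const by (auto simp: r_def point_character_apply)
  define \<sigma>' where "\<sigma>' = restrict (\<sigma> \<circ> r) (characters (lp p X))"
  have "r \<Phi> \<in> characters UNIV" if "\<Phi> \<in> characters (lp p X)" for \<Phi>
    using characters_lp_finite[OF that X(1) p] r by metis
  then have "continuous_map (gelfand_topology (lp p X)) (gelfand_topology UNIV) r"
    using const by (intro continuous_map_into_gelfand_topology)
      (auto simp: r_def intro: continuous_map_gelfand_evaluation)
  then have \<sigma>': "\<sigma>' \<in> Cb_characters (lp p X)"
    unfolding \<sigma>'_def by (rule Cb_characters_compose[OF \<sigma>])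
  have \<sigma>'_point: "\<sigma>' (point_character p X x \<phi>) = \<sigma> \<phi>" if "\<phi> \<in> characters UNIV" for \<phi>
    using that X p by (simp add: \<sigma>'_def point_character_in_characters r)
  show "\<sigma> \<in> BSE_functions UNIV norm"
  proof -
    have "\<sigma>' \<in> BSE_functions (lp p X) (lp_norm p X)"
      using \<sigma>' lp unfolding type_I_BSE_algebra_iff by blast
    then obtain \<beta> where \<beta>: "\<beta> > 0"
      "\<And>(n::nat) c \<Phi>. \<forall>j<n. \<Phi> j \<in> characters (lp p X) \<Longrightarrow>
        cmod (\<Sum>j<n. c j * \<sigma>' (\<Phi> j))
        \<le> \<beta> * dual_norm (lp p X) (lp_norm p X) (\<lambda>b. \<Sum>j<n. c j * \<Phi> j b)"
      unfolding BSE_functions_def by blast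
    \<comment> \<open>The combination is moved to the single point \<open>x\<close>, where
      \<open>\<sigma>'\<close> agrees with \<open>\<sigma>\<close> and the dual norm does not
      increase, so \<open>\<beta>\<close> is kept.\<close>
    have "cmod (\<Sum>j<n. c j * \<sigma> (\<phi> j)) \<le> \<beta> * dual_norm UNIV norm (\<lambda>b. \<Sum>j<n. c j * \<phi> j b)"
      if "\<forall>j<n. \<phi> j \<in> characters UNIV" for n :: nat and c and \<phi> :: "nat \<Rightarrow> 'a \<Rightarrow> complex"
    proof -
      have "cmod (\<Sum>j<n. c j * \<sigma> (\<phi> j)) = cmod (\<Sum>j<n. c j * \<sigma>' (point_character p X x (\<phi> j)))"
        using that by (simp add: \<sigma>'_point)
      also have "\<dots> \<le> \<beta> * dual_norm (lp p X) (lp_norm p X)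
          (\<lambda>b. \<Sum>j<n. c j * point_character p X x (\<phi> j) b)"
        using that X p by (intro \<beta>(2)) (auto simp: point_character_in_characters)
      also have "\<dots> \<le> \<beta> * dual_norm UNIV norm (\<lambda>b. \<Sum>j<n. c j * \<phi> j b)"
        using that X p \<beta>(1) by (intro mult_left_mono dual_norm_point_characters_le) auto
      finally show ?thesis .
    qed
    then show ?thesis
      using \<sigma> \<beta>(1) unfolding BSE_functions_def by blast
  qed
  show "\<sigma> \<in> multiplier_transforms UNIV norm"
  proof -
    have "\<sigma>' \<in> multiplier_transforms (lp p X) (lp_norm p X)"
      using \<sigma>' lp unfolding type_I_BSE_algebra_iff by blast
    then obtain T where T: "T \<in> multipliers (lp p X) (lp_norm p X)"
      and T\<sigma>: "\<And>f \<Phi>. f \<in> lp p X \<Longrightarrow> \<Phi> \<in> characters (lp p X) \<Longrightarrow> \<Phi> (T f) = \<sigma>' \<Phi> * \<Phi> f"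
      unfolding multiplier_transforms_def by blast
    \<comment> \<open>The compression of \<open>T\<close> to the coordinate \<open>x\<close>: embed
      isometrically, apply \<open>T\<close>, evaluate. The bound \<open>K\<close> survives since
      evaluation is contractive.\<close>
    define S where "S = (\<lambda>a. T (single x a) x)"
    have sl: "single x a \<in> lp p X" for a :: 'a
      by (rule single_in_lp[OF X(2) p])
    have T_in: "T (single x a) \<in> lp p X" for a
      using T sl unfolding multipliers_def by blast
    obtain K where K: "\<And>f. f \<in> lp p X \<Longrightarrow> lp_norm p X (T f) \<le> K * lp_norm p X f"
      using T unfolding multipliers_def by blast
    have "norm (S a) \<le> K * norm a" for a
      using norm_le_lp_norm[OF T_in p X(2), of a] K[OF sl, of a] lp_norm_single[OF X(2) p, of a]
      by (simp add: S_def)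
    moreover have "S (a + b) = S a + S b" "S (c *\<^sub>C a) = c *\<^sub>C S a" "S (a * b) = a * S b" for a b c
      using T sl by (auto simp: S_def multipliers_def single_add single_mult single_scaleC)
    ultimately have "S \<in> multipliers UNIV norm"
      unfolding multipliers_def by auto
    moreover have "\<phi> (S a) = \<sigma> \<phi> * \<phi> a" if "\<phi> \<in> characters UNIV" for \<phi> a
      using T\<sigma>[OF sl point_character_in_characters[OF that X(2) p], of a] that
      by (simp add: point_character_apply T_in sl S_def \<sigma>'_point)
    ultimately show ?thesis
      using \<sigma> unfolding multiplier_transforms_def by blast
  qed
qed

section \<open>From the base algebra to \<open>lp p X\<close>, for finite \<open>X\<close>\<close>

lemma type_I_BSE_algebra_lp_finite:
  fixes X :: "'x set"
  assumes A: "type_I_BSE_algebra (UNIV :: 'a::comm_cbanach_algebra set) norm"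
    and X: "finite X" and p: "0 < p"
  shows "type_I_BSE_algebra (lp p X :: ('x \<Rightarrow> 'a) set) (lp_norm p X)"
  unfolding type_I_BSE_algebra_iff
proof (intro conjI subsetI)
  show "without_order (lp p X :: ('x \<Rightarrow> 'a) set)"
    unfolding without_order_def
  proof (intro ballI impI)
    fix f :: "'x \<Rightarrow> 'a" assume f: "f \<in> lp p X" "\<forall>g\<in>lp p X. f * g = 0"
    have "f x = 0" if "x \<in> X" for x
    proof -
      have "f x * a = 0" for a
        using f(2) single_in_lp[OF that p, of a] by (metis mult_single single_same zero_fun_apply)
      then show ?thesis
        using A unfolding type_I_BSE_algebra_iff without_order_def by blast
    qed
    then show "f = 0" using lpD[OF f(1)] by fastforce
  qed
next
  fix \<sigma> assume \<sigma>: "\<sigma> \<in> Cb_characters (lp p X :: ('x \<Rightarrow> 'a) set)"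
  define \<sigma>' where "\<sigma>' = (\<lambda>x. restrict (\<sigma> \<circ> point_character p X x) (characters (UNIV :: 'a set)))"
  have \<sigma>': "\<sigma>' x \<in> Cb_characters UNIV" if "x \<in> X" for x
    unfolding \<sigma>'_def
    by (rule Cb_characters_compose[OF \<sigma> continuous_map_point_character[OF that p]])
  show "\<sigma> \<in> BSE_functions (lp p X) (lp_norm p X)"
  proof -
    define Q where "Q x \<beta> \<longleftrightarrow> (\<forall>(n::nat) c \<phi>. (\<forall>j<n. \<phi> j \<in> characters UNIV) \<longrightarrow>
        cmod (\<Sum>j<n. c j * \<sigma>' x (\<phi> j)) \<le> \<beta> * dual_norm UNIV norm (\<lambda>b. \<Sum>j<n. c j * \<phi> j b))"
      for x \<beta>
    have "\<exists>\<beta>>0. Q x \<beta>" if "x \<in> X" for x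
      using \<sigma>'[OF that] A unfolding type_I_BSE_algebra_iff BSE_functions_def Q_def by blast
    then obtain \<beta> where \<beta>: "\<And>x. x \<in> X \<Longrightarrow> \<beta> x > 0" "\<And>x. x \<in> X \<Longrightarrow> Q x (\<beta> x)"
      by metis
    \<comment> \<open>The slice constants add up; the summand \<open>1\<close> keeps the total
      positive also when \<open>X\<close> is empty.\<close>
    have "cmod (\<Sum>j<n. c j * \<sigma> (\<Phi> j)) \<le> (1 + (\<Sum>x\<in>X. \<beta> x)) *
        dual_norm (lp p X) (lp_norm p X) (\<lambda>b. \<Sum>j<n. c j * \<Phi> j b)"
      if \<Phi>: "\<forall>j<n. \<Phi> j \<in> characters (lp p X)"
      for n :: nat and c and \<Phi> :: "nat \<Rightarrow> ('x \<Rightarrow> 'a) \<Rightarrow> complex"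
    proof -
      have "\<forall>j. \<exists>x \<phi>. j < n \<longrightarrow> x \<in> X \<and> \<phi> \<in> characters UNIV \<and> \<Phi> j = point_character p X x \<phi>"
        using \<Phi> characters_lp_finite[OF _ X p] by metis
      then obtain x \<phi> where x: "\<And>j. j < n \<Longrightarrow> x j \<in> X"
        and \<phi>: "\<And>j. j < n \<Longrightarrow> \<phi> j \<in> characters UNIV"
        and \<Phi>_eq: "\<And>j. j < n \<Longrightarrow> \<Phi> j = point_character p X (x j) (\<phi> j)"
        by metis
      define D where "D = dual_norm (lp p X) (lp_norm p X) (\<lambda>b. \<Sum>j<n. c j * \<Phi> j b)"
      have D_eq: "D = dual_norm (lp p X) (lp_norm p X)
          (\<lambda>b. \<Sum>j<n. c j * point_character p X (x j) (\<phi> j) b)"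
        unfolding D_def using \<Phi>_eq by (intro arg_cong[where f = "dual_norm _ _"]) auto
      have D_ge: "cmod (\<Sum>j<n. c j * \<phi> j (f (x j))) \<le> D" if "f \<in> lp p X" "lp_norm p X f \<le> 1" for f
        unfolding D_eq by (rule norm_combination_le_dual_norm_lp[OF \<phi> x p that])
      have "0 \<le> D" using order_trans[OF norm_ge_zero D_ge[of 0]] by simp
      \<comment> \<open>Zero coefficients select the terms based at \<open>y\<close>, so every slice
        uses the same \<open>n\<close> and \<open>\<phi>\<close> without reindexing.\<close>
      let ?c = "\<lambda>y j. if x j = y then c j else 0"
      have part: "cmod (\<Sum>j<n. ?c y j * \<sigma>' y (\<phi> j)) \<le> \<beta> y * D" if "y \<in> X" for y
      proof -
        \<comment> \<open>The functions \<open>single y b\<close> have the norm of \<open>b\<close>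
          and make every term based at another point vanish, so \<open>D\<close> dominates the dual
          norm of each slice.\<close>
        have "dual_norm UNIV norm (\<lambda>b. \<Sum>j<n. ?c y j * \<phi> j b) \<le> D"
          unfolding dual_norm_def
        proof (rule cSUP_least)
          show "{b :: 'a. b \<in> UNIV \<and> norm b \<le> 1} \<noteq> {}"
            by (auto intro!: exI[of _ 0])
          fix b :: 'a assume "b \<in> {b. b \<in> UNIV \<and> norm b \<le> 1}"
          then have "cmod (\<Sum>j<n. c j * \<phi> j (single y b (x j))) \<le> D"
            by (intro D_ge) (auto simp: single_in_lp lp_norm_single that p)
          also have "(\<Sum>j<n. c j * \<phi> j (single y b (x j))) = (\<Sum>j<n. ?c y j * \<phi> j b)"
            by (rule sum.cong) (auto simp: single_def characters_zero[OF \<phi>])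
          finally show "cmod (\<Sum>j<n. ?c y j * \<phi> j b) \<le> D" .
        qed
        then show ?thesis
          using \<beta>[OF that] \<phi> unfolding Q_def
          by (meson less_imp_le mult_left_mono order_trans)
      qed
      have "(\<Sum>j<n. c j * \<sigma> (\<Phi> j)) = (\<Sum>j<n. \<Sum>y\<in>X. ?c y j * \<sigma>' y (\<phi> j))"
      proof (rule sum.cong)
        fix j assume j: "j \<in> {..<n}"
        then have "(\<Sum>y\<in>X. ?c y j * \<sigma>' y (\<phi> j)) = (\<Sum>y\<in>X. if x j = y then c j * \<sigma>' y (\<phi> j) else 0)"
          by (intro sum.cong) auto
        also have "\<dots> = c j * \<sigma> (\<Phi> j)"
          using j x X \<phi> \<Phi>_eq by (simp add: \<sigma>'_def)
        finally show "c j * \<sigma> (\<Phi> j) = (\<Sum>y\<in>X. ?c y j * \<sigma>' y (\<phi> j))" ..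
      qed simp
      also have "\<dots> = (\<Sum>y\<in>X. \<Sum>j<n. ?c y j * \<sigma>' y (\<phi> j))"
        by (rule sum.swap)
      also have "cmod \<dots> \<le> (\<Sum>y\<in>X. \<beta> y * D)"
        by (intro sum_norm_le part)
      also have "\<dots> \<le> (1 + (\<Sum>y\<in>X. \<beta> y)) * D"
        using \<open>0 \<le> D\<close> by (simp add: sum_distrib_right distrib_right)
      finally show ?thesis unfolding D_def .
    qed
    moreover have "1 + (\<Sum>x\<in>X. \<beta> x) > 0"
      using \<beta>(1) by (intro add_pos_nonneg sum_nonneg) (auto intro: less_imp_le)
    ultimately show ?thesis
      using \<sigma> unfolding BSE_functions_def by blast
  qed
  show "\<sigma> \<in> multiplier_transforms (lp p X) (lp_norm p X)"
  proof -
    have "\<forall>x\<in>X. \<sigma>' x \<in> multiplier_transforms UNIV norm"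
      using \<sigma>' A unfolding type_I_BSE_algebra_iff by blast
    then have "\<forall>x\<in>X. \<exists>T. T \<in> multipliers (UNIV :: 'a set) norm \<and>
        (\<forall>b. \<forall>\<phi>\<in>characters UNIV. \<phi> (T b) = \<sigma>' x \<phi> * \<phi> b)"
      by (simp add: multiplier_transforms_def Bex_def)
    from bchoice[OF this] obtain T where "\<forall>x\<in>X. T x \<in> multipliers (UNIV :: 'a set) norm \<and>
        (\<forall>b. \<forall>\<phi>\<in>characters UNIV. \<phi> (T x b) = \<sigma>' x \<phi> * \<phi> b)" ..
    then have T: "\<And>x. x \<in> X \<Longrightarrow> T x \<in> multipliers (UNIV :: 'a set) norm"
      and T\<sigma>: "\<And>x b \<phi>. x \<in> X \<Longrightarrow> \<phi> \<in> characters UNIV \<Longrightarrow> \<phi> (T x b) = \<sigma>' x \<phi> * \<phi> b"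
      by blast+
    have T_add: "T x (a + b) = T x a + T x b" and T_scaleC: "T x (c *\<^sub>C a) = c *\<^sub>C T x a"
      and T_mult: "T x (a * b) = a * T x b" if "x \<in> X" for x a b c
      using T[OF that] unfolding multipliers_def by blast+
    have "\<exists>K. \<forall>a. norm (T x a) \<le> K * norm a" if "x \<in> X" for x
      using T[OF that] unfolding multipliers_def by blast
    then obtain K where K: "\<And>x a. x \<in> X \<Longrightarrow> norm (T x a) \<le> K x * norm a"
      by metis
    \<comment> \<open>The slice multipliers act coordinatewise; the value \<open>0\<close> off
      \<open>X\<close> keeps \<open>S f\<close> in \<open>lp p X\<close>, and
      \<open>restrict\<close> supplies the extensionality that \<open>multipliers\<close>
      requires.\<close>
    define S where "S = restrict (\<lambda>f x. if x \<in> X then T x (f x) else 0) (lp p X)"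
    have S_apply: "S f x = (if x \<in> X then T x (f x) else 0)" if "f \<in> lp p X" for f x
      using that by (simp add: S_def)
    have S_in: "S f \<in> lp p X" if "f \<in> lp p X" for f
      using that X by (simp add: lp_finite S_apply)
    \<comment> \<open>One constant serves all coordinates. Absolute values are taken because the
      \<open>K x\<close> are not known to be nonnegative.\<close>
    define L where "L = (\<Sum>x\<in>X. \<bar>K x\<bar>)"
    have "0 \<le> L" by (simp add: L_def sum_nonneg)
    have "lp_norm p X (S f) \<le> L * lp_norm p X f" if "f \<in> lp p X" for f
    proof -
      have "norm (S f x) powr p \<le> L powr p * norm (f x) powr p" if "x \<in> X" for x
      proof -
        have "K x \<le> L"
          using member_le_sum[OF that, of "\<lambda>x. \<bar>K x\<bar>"] X by (simp add: L_def)
        then have "norm (S f x) \<le> L * norm (f x)"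
          using K[OF that, of "f x"] that \<open>f \<in> lp p X\<close>
          by (simp add: S_apply) (meson mult_right_mono norm_ge_zero order_trans)
        then have "norm (S f x) powr p \<le> (L * norm (f x)) powr p"
          using p by (intro powr_mono2) auto
        then show ?thesis using \<open>0 \<le> L\<close> by (simp add: powr_mult)
      qed
      then have "(\<Sum>x\<in>X. norm (S f x) powr p) \<le> L powr p * (\<Sum>x\<in>X. norm (f x) powr p)"
        by (simp add: sum_distrib_left sum_mono)
      then have "lp_norm p X (S f) \<le> (L powr p * (\<Sum>x\<in>X. norm (f x) powr p)) powr (1 / p)"
        unfolding lp_norm_finite[OF X] using p by (intro powr_mono2) (auto intro: sum_nonneg)
      also have "\<dots> = L * lp_norm p X f"
        unfolding lp_norm_finite[OF X] using p \<open>0 \<le> L\<close>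
        by (simp add: powr_mult powr_powr sum_nonneg)
      finally show ?thesis .
    qed
    moreover have "S (f + g) = S f + S g" "S (c *\<^sub>C f) = c *\<^sub>C S f" "S (f * g) = f * S g"
      if "f \<in> lp p X" "g \<in> lp p X" for f g c
      using that p
      by (auto simp: fun_eq_iff S_apply lp_add lp_mult lp_scaleC T_add T_scaleC T_mult)
    ultimately have "S \<in> multipliers (lp p X) (lp_norm p X)"
      using S_in unfolding multipliers_def by (auto simp: S_def)
    moreover have "\<Phi> (S f) = \<sigma> \<Phi> * \<Phi> f" if f: "f \<in> lp p X" and \<Phi>: "\<Phi> \<in> characters (lp p X)" for f \<Phi>
    proof -
      obtain x \<phi> where "x \<in> X" "\<phi> \<in> characters UNIV" "\<Phi> = point_character p X x \<phi>"
        using characters_lp_finite[OF \<Phi> X p] .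
      then show ?thesis
        using T\<sigma>[of x \<phi> "f x"] f
        by (simp add: point_character_apply S_in S_apply \<sigma>'_def)
    qed
    ultimately show ?thesis
      using \<sigma> unfolding multiplier_transforms_def by blast
  qed
qed

theorem theorem3p1:
  fixes X :: "'x set" and p :: real
  assumes "characters (UNIV :: 'a::comm_cbanach_algebra set) \<noteq> {}"
    and "X \<noteq> {}"
    and "1 \<le> p"
  shows "type_I_BSE_algebra (lp p X :: ('x \<Rightarrow> 'a) set) (lp_norm p X) \<longleftrightarrow>
    finite X \<and> type_I_BSE_algebra (UNIV :: 'a set) norm"
proof
  have p: "0 < p" using assms(3) by simp
  obtain x where x: "x \<in> X" using assms(2) by blast
  obtain \<phi> where \<phi>: "\<phi> \<in> characters (UNIV :: 'a set)" using assms(1) by blast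
  assume lp: "type_I_BSE_algebra (lp p X :: ('x \<Rightarrow> 'a) set) (lp_norm p X)"
  \<comment> \<open>The constant function \<open>1\<close> lies in \<open>Cb_characters\<close> but
    is not a BSE function for infinite \<open>X\<close>.\<close>
  have "finite X"
    using infinite_one_notin_BSE_functions[OF \<phi> _ p] Cb_characters_one lp
    unfolding type_I_BSE_algebra_iff by blast
  then show "finite X \<and> type_I_BSE_algebra (UNIV :: 'a set) norm"
    using type_I_BSE_algebra_base[OF lp _ x p] by blast
next
  assume "finite X \<and> type_I_BSE_algebra (UNIV :: 'a set) norm"
  then show "type_I_BSE_algebra (lp p X :: ('x \<Rightarrow> 'a) set) (lp_norm p X)"
    using type_I_BSE_algebra_lp_finite[of X p] assms(3) by auto
qed

end
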